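(* Let $F$ be an algebraically closed field of characteristic zero. The following 36 Rota--Baxter operators of weight $1$ on $M_3(F)$ lie in pairwise different orbits under the action of $\phi$ and conjugation with automorphisms of $M_3(F)$ and transpose (here $R'=-(R+\mathrm{id})$). A) The 20 primitive operators (defined in the context) $1a$--$7a$, $1b$--$7b$, and $1c,2c,3c,4c,6c,7c$. B) The four linear operators: 1-I) $R(e_{11})=e_{22}+e_{33}$, $R(e_{22})=e_{33}$; $e_{31},e_{32},e_{33}\in\ker(R)$; $e_{12},e_{13}\in\ker(R')$; $R(e_{21})=-e_{32}$, $R(e_{23})=e_{12}-e_{23}$; 6-I) $e_{22},e_{23},e_{32},e_{33}\in\ker(R)$, $R(e_{11})=e_{22}$, $R(e_{12})=-e_{12}-e_{32}$, $R(e_{21})=-e_{21}+e_{23}$, $R(e_{13})=e_{11}+e_{22}-e_{13}$, $R(e_{31})=-e_{31}+e_{33}$; 6-II) $e_{12},e_{13},e_{22},e_{23},e_{32},e_{33}\in\ker(R)$, $R(e_{11})=e_{22}$, $R(e_{21})=-e_{21}$, $R(e_{31})=-e_{31}+e_{11}+e_{22}$; 6-III) $e_{12},e_{13},e_{22},e_{23},e_{32},e_{33}\in\ker(R)$, $R(e_{11})=e_{22}$, $R(e_{21})=-e_{21}-e_{23}$, $R(e_{31})=-e_{31}+e_{11}+e_{22}$. C) The twelve linear operators with $e_{12},e_{13}\in\ker(R')$, $e_{21},e_{31}\in\ker(R)$ and, in addition: 2-I) $R(e_{11})=e_{22}+e_{33}$, $R(e_{22})=e_{33}$; $e_{23},e_{33}\in\ker(R')$,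 $R(e_{32})=e_{33}$; 2-II) $R(e_{11})=e_{22}+e_{33}$, $R(e_{22})=e_{33}$; $e_{32},e_{33}\in\ker(R')$, $R(e_{23})=e_{33}$; 3-I) $e_{11},e_{23}\in\ker(R')$, $-R(e_{22})=R(e_{33})=e_{11}+e_{22}$, $R(e_{32})=e_{11}+e_{22}$; 3-II) $e_{11},e_{32}\in\ker(R')$, $-R(e_{22})=R(e_{33})=e_{11}+e_{22}$, $R(e_{23})=e_{11}+e_{22}$; 4-I) $R(e_{22})=e_{11}+e_{33}$; $e_{33},e_{32}\in\ker(R')$, $e_{11}\in\ker(R)$, $R(e_{23})=e_{33}$; 4-II) $R(e_{22})=e_{11}+e_{33}$; $e_{33},e_{23}\in\ker(R')$, $e_{11}\in\ker(R)$, $R(e_{32})=e_{33}$; 5-I) $R(e_{11})=e_{22}+e_{33}$; $e_{22},e_{23},e_{32},e_{33}\in\ker(R)$; 5-II) $R(e_{11})=e_{22}+e_{33}$; $e_{22},e_{23},e_{33}\in\ker(R)$, $R(e_{32})=e_{33}-e_{32}$; 6-IV) $e_{11},e_{33},e_{32}\in\ker(R)$, $R(e_{22})=e_{11}$, $R(e_{23})=-e_{23}+e_{11}+e_{22}$; 6-V) $e_{11},e_{33},e_{23}\in\ker(R)$, $R(e_{22})=e_{11}$, $R(e_{32})=-e_{32}+e_{11}+e_{22}$; 6-VI) $e_{22},e_{33},e_{23},e_{32}\in\ker(R)$, $R(e_{11})=e_{22}$; 8-I) $e_{11}\in\ker(R')$, $e_{22},e_{23},e_{33}\in\ker(R)$,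 $R(e_{32})=e_{11}+e_{22}-e_{32}$.
   Context: Rota--Baxter (RB) operators. Given an associative algebra $A$ over a field $F$ and $\lambda\in F$, a linear operator $R\colon A\to A$ is a Rota--Baxter operator of weight $\lambda$ if $R(x)R(y)=R(R(x)y+xR(y)+\lambda xy)$ for all $x,y\in A$. Actions. For an RB-operator $R$ of weight $1$: $\phi(R)=R'=-(R+\mathrm{id})$ is again an RB-operator of weight $1$; conjugation with an algebra automorphism $\psi$ is $R\mapsto\psi^{-1}R\psi$; conjugation with transpose $T$ is $R\mapsto TRT$. The orbit of $R$ is its orbit under the group generated by $\phi$, conjugations with all automorphisms of $M_3(F)$, and conjugation with transpose. Notation. $e_{ij}$ are the matrix units of $M_3(F)$; $D_3$ is the subalgebra of diagonal matrices; $U_3=\mathrm{Span}\{e_{12},e_{13},e_{23}\}$ and $L_3=\mathrm{Span}\{e_{21},e_{31},e_{32}\}$ are the strictly upper and strictly lower triangular matrices. $\Phi_{ab}$ is the automorphism of $M_3(F)$ permuting the indices of matrix units by the transposition $(a\,b)$. Primitive operators. Given an RB-operator $R_0$ of weight $1$ on $D_3$, the corresponding primitive operator on $M_3(F)=U_3\oplus D_3\oplus L_3$ is $R(u+d+l)=R_0(d)-l$ for $u\in U_3$, $d\in D_3$, $l\in L_3$. Let $\rho_1,\dots,\rho_7$ be the following operators on $D_3$ (with $f_i=e_{ii}$): - $\rho_1$: $f_1\mapsto f_2+f_3$, $f_2\mapsto f_3$, $f_3\mapsto 0$; - $\rho_2$: $f_1\mapsto f_2+f_3$, $f_2\mapsto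 f_3$, $f_3\mapsto -f_3$; - $\rho_3$: $f_1\mapsto f_2+f_3$, $f_2\mapsto -(f_2+f_3)$, $f_3\mapsto -f_3$; - $\rho_4$: $f_1\mapsto f_2+f_3$, $f_2\mapsto -f_2$, $f_3\mapsto 0$; - $\rho_5$: $f_1\mapsto f_2+f_3$, $f_2\mapsto 0$, $f_3\mapsto 0$; - $\rho_6$: $f_1\mapsto f_2$, $f_2\mapsto 0$, $f_3\mapsto 0$; - $\rho_7$: $f_1\mapsto f_2$, $f_2\mapsto 0$, $f_3\mapsto -f_3$. For $X\in\{1,\dots,7\}$, the operator $Xa$ is the primitive operator with $R_0=\rho_X$; $Xb$ is the primitive operator with $R_0=\Phi_{12}^{-1}\rho_X\Phi_{12}$; $Xc$ is the primitive operator with $R_0=\Phi_{23}^{-1}\rho_X\Phi_{23}$ (automorphisms restricted to $D_3$). *)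

theory Defs
  imports
    "HOL-Analysis.Analysis"
    "HOL-Algebra.Group_Action"
    "HOL-Algebra.Generated_Groups"
begin

section \<open>The algebra of 3 by 3 matrices\<close>

type_synonym 'a mat3 = "'a ^ 3 ^ 3"

text \<open>The library's \<open>*s\<close> on \<open>'a ^ 3 ^ 3\<close> multiplies rows by vectors in \<open>'a ^ 3\<close>, so scaling by
  a field element is defined here.\<close>

definition mscale :: "'a::field \<Rightarrow> 'a mat3 \<Rightarrow> 'a mat3"
  where "mscale c x = (\<chi> i j. c * x $ i $ j)"

interpretation mat3: vector_space "mscale :: 'a::field \<Rightarrow> 'a mat3 \<Rightarrow> 'a mat3"
  by unfold_locales (simp_all add: mscale_def vec_eq_iff algebra_simps)

definition E :: "3 \<Rightarrow> 3 \<Rightarrow> 'a::field mat3"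
  where "E i j = (\<chi> k l. if k = i \<and> l = j then 1 else 0)"

abbreviation mlinear :: "('a::field mat3 \<Rightarrow> 'a mat3) \<Rightarrow> bool"
  where "mlinear \<equiv> Vector_Spaces.linear mscale mscale"

lemma mlinearI:
  assumes "\<And>x y. R (x + y) = R x + R y" "\<And>c x. R (mscale c x) = mscale c (R x)"
  shows "mlinear R"
  using assms
  by (simp add: Vector_Spaces.linear_def module_hom_def module_hom_axioms_def
      mat3.vector_space_axioms mat3.module_axioms)

definition algebra_automorphism :: "('a::field mat3 \<Rightarrow> 'a mat3) \<Rightarrow> bool"
  where "algebra_automorphism \<psi> \<longleftrightarrow>
    mlinear \<psi> \<and> bij \<psi> \<and> (\<forall>x y. \<psi> (x ** y) = \<psi> x ** \<psi> y)"


section \<open>Rota--Baxter operators and their orbits\<close>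

definition rota_baxter :: "'a::field \<Rightarrow> ('a mat3 \<Rightarrow> 'a mat3) \<Rightarrow> bool"
  where "rota_baxter w R \<longleftrightarrow> mlinear R \<and>
    (\<forall>x y. R x ** R y = R (R x ** y + x ** R y + mscale w (x ** y)))"

definition phi_op :: "('a::field mat3 \<Rightarrow> 'a mat3) \<Rightarrow> ('a mat3 \<Rightarrow> 'a mat3)"
  where "phi_op R = (\<lambda>x. - (R x + x))"

definition conj_aut :: "('a::field mat3 \<Rightarrow> 'a mat3) \<Rightarrow> ('a mat3 \<Rightarrow> 'a mat3) \<Rightarrow> ('a mat3 \<Rightarrow> 'a mat3)"
  where "conj_aut \<psi> R = inv_into UNIV \<psi> \<circ> R \<circ> \<psi>"

definition conj_transpose :: "('a::field mat3 \<Rightarrow> 'a mat3) \<Rightarrow> ('a mat3 \<Rightarrow> 'a mat3)"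
  where "conj_transpose R =
    Finite_Cartesian_Product.transpose \<circ> R \<circ> Finite_Cartesian_Product.transpose"

definition action_generators :: "(('a::field mat3 \<Rightarrow> 'a mat3) \<Rightarrow> ('a mat3 \<Rightarrow> 'a mat3)) set"
  where "action_generators =
    {phi_op} \<union> {conj_aut \<psi> | \<psi>. algebra_automorphism \<psi>} \<union> {conj_transpose}"

text \<open>The group is taken inside the permutations of all self-maps of the matrix algebra. Its
  elements map Rota--Baxter operators of weight 1 to such operators, so the orbits of the latter
  do not depend on this choice of the ambient set.\<close>

definition action_group :: "(('a::field mat3 \<Rightarrow> 'a mat3) \<Rightarrow> ('a mat3 \<Rightarrow> 'a mat3)) monoid"
  where "action_group = subgroup_generated (BijGroup UNIV) action_generators"

definition rb_orbit :: "('a::field mat3 \<Rightarrow> 'a mat3) \<Rightarrow> ('a mat3 \<Rightarrow> 'a mat3) set"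
  where "rb_orbit R = Group_Action.orbit action_group (\<lambda>g. g) R"

lemma action_generators_subset: "action_generators \<subseteq> carrier (BijGroup UNIV)"
proof
  fix g :: "('a mat3 \<Rightarrow> 'a mat3) \<Rightarrow> ('a mat3 \<Rightarrow> 'a mat3)"
  assume "g \<in> action_generators"
  then consider "g = phi_op" | \<psi> where "g = conj_aut \<psi>" "algebra_automorphism \<psi>"
    | "g = conj_transpose"
    by (auto simp: action_generators_def)
  then have "bij g"
  proof cases
    case 1
    then show ?thesis by (intro o_bij[of phi_op]) (auto simp: phi_op_def fun_eq_iff)
  next
    case 2
    then have "bij \<psi>" by (simp add: algebra_automorphism_def)
    then have "inv_into UNIV \<psi> (\<psi> x) = x" "\<psi> (inv_into UNIV \<psi> x) = x" for x
      by (auto simp: bij_def surj_f_inv_f)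
    then show ?thesis
      using 2 by (intro o_bij[of "\<lambda>R. \<psi> \<circ> R \<circ> inv_into UNIV \<psi>"]) (auto simp: conj_aut_def fun_eq_iff)
  next
    case 3
    then show ?thesis by (intro o_bij[of conj_transpose]) (auto simp: conj_transpose_def fun_eq_iff)
  qed
  then show "g \<in> carrier (BijGroup UNIV)"
    by (simp add: BijGroup_def Bij_def)
qed


section \<open>Primitive operators\<close>

definition D3 :: "'a::field mat3 set" where "D3 = mat3.span {E 1 1, E 2 2, E 3 3}"
definition U3 :: "'a::field mat3 set" where "U3 = mat3.span {E 1 2, E 1 3, E 2 3}"
definition L3 :: "'a::field mat3 set" where "L3 = mat3.span {E 2 1, E 3 1, E 3 2}"

definition diag_part :: "'a::field mat3 \<Rightarrow> 'a mat3"
  where "diag_part x =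
    mscale (x $ 1 $ 1) (E 1 1) + mscale (x $ 2 $ 2) (E 2 2) + mscale (x $ 3 $ 3) (E 3 3)"

text \<open>Written out entrywise because in the order of type \<open>3\<close> the index \<open>3\<close>, being equal
  to \<open>0\<close>, comes first.\<close>

definition lower_part :: "'a::field mat3 \<Rightarrow> 'a mat3"
  where "lower_part x =
    mscale (x $ 2 $ 1) (E 2 1) + mscale (x $ 3 $ 1) (E 3 1) + mscale (x $ 3 $ 2) (E 3 2)"

text \<open>Operators on \<open>D3\<close> are represented by maps on all matrices, of which only the
  restriction to \<open>D3\<close> matters.\<close>

definition primitive :: "('a::field mat3 \<Rightarrow> 'a mat3) \<Rightarrow> ('a mat3 \<Rightarrow> 'a mat3)"
  where "primitive R0 x = R0 (diag_part x) - lower_part x"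

lemma primitive_decomp:
  assumes "u \<in> U3" "d \<in> D3" "l \<in> L3"
  shows "primitive R0 (u + d + l) = R0 d - l"
proof -
  have u: "diag_part u = 0 \<and> lower_part u = 0"
    using assms(1) unfolding U3_def
    by (induction rule: mat3.span_induct_alt)
      (auto simp: diag_part_def lower_part_def E_def mscale_def vec_eq_iff algebra_simps forall_3)
  have d: "diag_part d = d \<and> lower_part d = 0"
    using assms(2) unfolding D3_def
    by (induction rule: mat3.span_induct_alt)
      (auto simp: diag_part_def lower_part_def E_def mscale_def vec_eq_iff algebra_simps forall_3)
  have l: "diag_part l = 0 \<and> lower_part l = l"
    using assms(3) unfolding L3_def
    by (induction rule: mat3.span_induct_alt)
      (auto simp: diag_part_def lower_part_def E_def mscale_def vec_eq_iff algebra_simps forall_3)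
  have "diag_part (u + d + l) = diag_part u + diag_part d + diag_part l"
       "lower_part (u + d + l) = lower_part u + lower_part d + lower_part l"
    by (simp_all add: diag_part_def lower_part_def mat3.scale_left_distrib)
  with u d l show ?thesis by (simp add: primitive_def)
qed

definition diag_op :: "'a::field mat3 \<Rightarrow> 'a mat3 \<Rightarrow> 'a mat3 \<Rightarrow> 'a mat3 \<Rightarrow> 'a mat3"
  where "diag_op r1 r2 r3 d =
    mscale (d $ 1 $ 1) r1 + mscale (d $ 2 $ 2) r2 + mscale (d $ 3 $ 3) r3"

lemma diag_op_units:
  "diag_op r1 r2 r3 (E 1 1) = r1" "diag_op r1 r2 r3 (E 2 2) = r2" "diag_op r1 r2 r3 (E 3 3) = r3"
  by (simp_all add: diag_op_def E_def)

definition rho1 :: "'a::field mat3 \<Rightarrow> 'a mat3"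
  where "rho1 = diag_op (E 2 2 + E 3 3) (E 3 3) 0"
definition rho2 :: "'a::field mat3 \<Rightarrow> 'a mat3"
  where "rho2 = diag_op (E 2 2 + E 3 3) (E 3 3) (- E 3 3)"
definition rho3 :: "'a::field mat3 \<Rightarrow> 'a mat3"
  where "rho3 = diag_op (E 2 2 + E 3 3) (- (E 2 2 + E 3 3)) (- E 3 3)"
definition rho4 :: "'a::field mat3 \<Rightarrow> 'a mat3"
  where "rho4 = diag_op (E 2 2 + E 3 3) (- E 2 2) 0"
definition rho5 :: "'a::field mat3 \<Rightarrow> 'a mat3"
  where "rho5 = diag_op (E 2 2 + E 3 3) 0 0"
definition rho6 :: "'a::field mat3 \<Rightarrow> 'a mat3"
  where "rho6 = diag_op (E 2 2) 0 0"
definition rho7 :: "'a::field mat3 \<Rightarrow> 'a mat3"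
  where "rho7 = diag_op (E 2 2) 0 (- E 3 3)"

definition \<Phi> :: "3 \<Rightarrow> 3 \<Rightarrow> 'a::field mat3 \<Rightarrow> 'a mat3"
  where "\<Phi> a b x =
    (\<chi> i j. x $ Transposition.transpose a b i $ Transposition.transpose a b j)"

lemma \<Phi>_E: "\<Phi> a b (E i j) = E (Transposition.transpose a b i) (Transposition.transpose a b j)"
  by (auto simp: \<Phi>_def E_def vec_eq_iff Transposition.transpose_def)

lemma algebra_automorphism_\<Phi>: "algebra_automorphism (\<Phi> a b)"
  unfolding algebra_automorphism_def
proof (intro conjI allI)
  show "mlinear (\<Phi> a b)"
    by (rule mlinearI) (simp_all add: \<Phi>_def mscale_def vec_eq_iff)
  show "bij (\<Phi> a b)"
    by (intro o_bij[of "\<Phi> a b"]) (auto simp: \<Phi>_def fun_eq_iff vec_eq_iff)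
  show "\<Phi> a b (x ** y) = \<Phi> a b x ** \<Phi> a b y" for x y :: "'a mat3"
    unfolding vec_eq_iff \<Phi>_def matrix_matrix_mult_def
    by (auto intro!: sum.reindex_bij_witness[where i = "Transposition.transpose a b"
          and j = "Transposition.transpose a b"])
qed

definition op_a :: "('a::field mat3 \<Rightarrow> 'a mat3) \<Rightarrow> ('a mat3 \<Rightarrow> 'a mat3)"
  where "op_a \<rho> = primitive \<rho>"
definition op_b :: "('a::field mat3 \<Rightarrow> 'a mat3) \<Rightarrow> ('a mat3 \<Rightarrow> 'a mat3)"
  where "op_b \<rho> = primitive (conj_aut (\<Phi> 1 2) \<rho>)"
definition op_c :: "('a::field mat3 \<Rightarrow> 'a mat3) \<Rightarrow> ('a mat3 \<Rightarrow> 'a mat3)"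
  where "op_c \<rho> = primitive (conj_aut (\<Phi> 2 3) \<rho>)"

definition ops_A :: "('a::field mat3 \<Rightarrow> 'a mat3) list"
  where "ops_A =
    map op_a [rho1, rho2, rho3, rho4, rho5, rho6, rho7] @
    map op_b [rho1, rho2, rho3, rho4, rho5, rho6, rho7] @
    map op_c [rho1, rho2, rho3, rho4, rho6, rho7]"


section \<open>The sixteen other operators\<close>

text \<open>The linear operator with \<open>E i j\<close> mapped to \<open>rij\<close>; the arguments below are laid out as
  a 3 by 3 table. Note that \<open>x\<close> lies in the kernel of \<open>phi_op R\<close> iff \<open>R x = - x\<close>.\<close>

definition lin_op :: "'a::field mat3 \<Rightarrow> 'a mat3 \<Rightarrow> 'a mat3 \<Rightarrow> 'a mat3 \<Rightarrow> 'a mat3 \<Rightarrow> 'a mat3 \<Rightarrow>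
    'a mat3 \<Rightarrow> 'a mat3 \<Rightarrow> 'a mat3 \<Rightarrow> 'a mat3 \<Rightarrow> 'a mat3"
  where "lin_op r11 r12 r13 r21 r22 r23 r31 r32 r33 x =
    mscale (x $ 1 $ 1) r11 + mscale (x $ 1 $ 2) r12 + mscale (x $ 1 $ 3) r13 +
    mscale (x $ 2 $ 1) r21 + mscale (x $ 2 $ 2) r22 + mscale (x $ 2 $ 3) r23 +
    mscale (x $ 3 $ 1) r31 + mscale (x $ 3 $ 2) r32 + mscale (x $ 3 $ 3) r33"

lemma mlinear_lin_op: "mlinear (lin_op r11 r12 r13 r21 r22 r23 r31 r32 r33)"
  by (rule mlinearI) (simp_all add: lin_op_def mscale_def vec_eq_iff algebra_simps)

lemma lin_op_units:
  "lin_op r11 r12 r13 r21 r22 r23 r31 r32 r33 (E 1 1) = r11"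
  "lin_op r11 r12 r13 r21 r22 r23 r31 r32 r33 (E 1 2) = r12"
  "lin_op r11 r12 r13 r21 r22 r23 r31 r32 r33 (E 1 3) = r13"
  "lin_op r11 r12 r13 r21 r22 r23 r31 r32 r33 (E 2 1) = r21"
  "lin_op r11 r12 r13 r21 r22 r23 r31 r32 r33 (E 2 2) = r22"
  "lin_op r11 r12 r13 r21 r22 r23 r31 r32 r33 (E 2 3) = r23"
  "lin_op r11 r12 r13 r21 r22 r23 r31 r32 r33 (E 3 1) = r31"
  "lin_op r11 r12 r13 r21 r22 r23 r31 r32 r33 (E 3 2) = r32"
  "lin_op r11 r12 r13 r21 r22 r23 r31 r32 r33 (E 3 3) = r33"
  by (simp_all add: lin_op_def E_def)

definition op_1_I :: "'a::field mat3 \<Rightarrow> 'a mat3"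
  where "op_1_I = lin_op
    (E 2 2 + E 3 3)    (- E 1 2)    (- E 1 3)
    (- E 3 2)          (E 3 3)      (E 1 2 - E 2 3)
    0                  0            0"

definition op_6_I :: "'a::field mat3 \<Rightarrow> 'a mat3"
  where "op_6_I = lin_op
    (E 2 2)            (- E 1 2 - E 3 2)    (E 1 1 + E 2 2 - E 1 3)
    (- E 2 1 + E 2 3)  0                    0
    (- E 3 1 + E 3 3)  0                    0"

definition op_6_II :: "'a::field mat3 \<Rightarrow> 'a mat3"
  where "op_6_II = lin_op
    (E 2 2)                      0    0
    (- E 2 1)                    0    0
    (- E 3 1 + E 1 1 + E 2 2)    0    0"

definition op_6_III :: "'a::field mat3 \<Rightarrow> 'a mat3"
  where "op_6_III = lin_op
    (E 2 2)                      0    0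
    (- E 2 1 - E 2 3)            0    0
    (- E 3 1 + E 1 1 + E 2 2)    0    0"

definition ops_B :: "('a::field mat3 \<Rightarrow> 'a mat3) list"
  where "ops_B = [op_1_I, op_6_I, op_6_II, op_6_III]"

definition lin_op_C :: "'a::field mat3 \<Rightarrow> 'a mat3 \<Rightarrow> 'a mat3 \<Rightarrow> 'a mat3 \<Rightarrow> 'a mat3 \<Rightarrow> 'a mat3 \<Rightarrow> 'a mat3"
  where "lin_op_C r11 r22 r23 r32 r33 = lin_op
    r11    (- E 1 2)    (- E 1 3)
    0      r22          r23
    0      r32          r33"

definition op_2_I :: "'a::field mat3 \<Rightarrow> 'a mat3"
  where "op_2_I = lin_op_C (E 2 2 + E 3 3)
    (E 3 3)    (- E 2 3)
    (E 3 3)    (- E 3 3)"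

definition op_2_II :: "'a::field mat3 \<Rightarrow> 'a mat3"
  where "op_2_II = lin_op_C (E 2 2 + E 3 3)
    (E 3 3)      (E 3 3)
    (- E 3 2)    (- E 3 3)"

definition op_3_I :: "'a::field mat3 \<Rightarrow> 'a mat3"
  where "op_3_I = lin_op_C (- E 1 1)
    (- (E 1 1 + E 2 2))    (- E 2 3)
    (E 1 1 + E 2 2)        (E 1 1 + E 2 2)"

definition op_3_II :: "'a::field mat3 \<Rightarrow> 'a mat3"
  where "op_3_II = lin_op_C (- E 1 1)
    (- (E 1 1 + E 2 2))    (E 1 1 + E 2 2)
    (- E 3 2)              (E 1 1 + E 2 2)"

definition op_4_I :: "'a::field mat3 \<Rightarrow> 'a mat3"
  where "op_4_I = lin_op_C 0
    (E 1 1 + E 3 3)    (E 3 3)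
    (- E 3 2)          (- E 3 3)"

definition op_4_II :: "'a::field mat3 \<Rightarrow> 'a mat3"
  where "op_4_II = lin_op_C 0
    (E 1 1 + E 3 3)    (- E 2 3)
    (E 3 3)            (- E 3 3)"

definition op_5_I :: "'a::field mat3 \<Rightarrow> 'a mat3"
  where "op_5_I = lin_op_C (E 2 2 + E 3 3)
    0    0
    0    0"

definition op_5_II :: "'a::field mat3 \<Rightarrow> 'a mat3"
  where "op_5_II = lin_op_C (E 2 2 + E 3 3)
    0                  0
    (E 3 3 - E 3 2)    0"

definition op_6_IV :: "'a::field mat3 \<Rightarrow> 'a mat3"
  where "op_6_IV = lin_op_C 0
    (E 1 1)    (- E 2 3 + E 1 1 + E 2 2)
    0          0"

definition op_6_V :: "'a::field mat3 \<Rightarrow> 'a mat3"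
  where "op_6_V = lin_op_C 0
    (E 1 1)                      0
    (- E 3 2 + E 1 1 + E 2 2)    0"

definition op_6_VI :: "'a::field mat3 \<Rightarrow> 'a mat3"
  where "op_6_VI = lin_op_C (E 2 2)
    0    0
    0    0"

definition op_8_I :: "'a::field mat3 \<Rightarrow> 'a mat3"
  where "op_8_I = lin_op_C (- E 1 1)
    0                            0
    (E 1 1 + E 2 2 - E 3 2)      0"

definition ops_C :: "('a::field mat3 \<Rightarrow> 'a mat3) list"
  where "ops_C = [op_2_I, op_2_II, op_3_I, op_3_II, op_4_I, op_4_II, op_5_I, op_5_II,
    op_6_IV, op_6_V, op_6_VI, op_8_I]"

definition rb_ops :: "('a::field mat3 \<Rightarrow> 'a mat3) list"
  where "rb_ops = ops_A @ ops_B @ ops_C"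

lemma length_rb_ops: "length rb_ops = 36"
  by (simp add: rb_ops_def ops_A_def ops_B_def ops_C_def)

end

theory Submission imports Defs begin

text \<open>
  Every operator in the orbit of \<open>R\<close> is conjugate to \<open>R\<close> or to \<open>\<phi>(R)\<close> under a linear bijection
  that is multiplicative or antimultiplicative. Such a map preserves traces and, up to sign,
  commutators. In terms of \<open>q = R - \<phi>(R) = 2R + id\<close> the map \<open>\<phi>\<close> is just the sign change of \<open>q\<close>.
  Let \<open>s\<close> be the matrix representing the functional \<open>x \<mapsto> tr q(x)\<close> in the trace form, i.e.
  the image of the unit under the adjoint of \<open>q\<close>, and let \<open>y = q(s)\<close>, \<open>z = q(y)\<close>. Then the
  quantities \<open>Tr(q) tr(s)\<close> and \<open>Tr(q \<circ> ad z)\<^sup>2\<close> and the truth value of \<open>[q, ad y] = 0\<close> are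
  constant on orbits. Their values tell the 36 operators apart, with the only exception of the
  pair 6-II, 6-III. For 6-III the algebra \<open>B = R(M\<^sub>3)\<close> satisfies \<open>B [B, B] B = 0\<close>; for 6-II
  this identity fails both for \<open>R\<close> and for \<open>\<phi>(R)\<close>.
\<close>

section \<open>Traces and symmetries of the matrix algebra\<close>

definition alg_symmetry :: "('a::field mat3 \<Rightarrow> 'a mat3) \<Rightarrow> bool"
  where "alg_symmetry \<psi> \<longleftrightarrow> mlinear \<psi> \<and> bij \<psi> \<and>
    ((\<forall>x y. \<psi> (x ** y) = \<psi> x ** \<psi> y) \<or> (\<forall>x y. \<psi> (x ** y) = \<psi> y ** \<psi> x))"

definition op_trace :: "('a::field mat3 \<Rightarrow> 'a mat3) \<Rightarrow> 'a"
  where "op_trace T = (\<Sum>i\<in>UNIV. \<Sum>j\<in>UNIV. T (E i j) $ i $ j)"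

definition bracket :: "'a::field mat3 \<Rightarrow> 'a mat3 \<Rightarrow> 'a mat3"
  where "bracket x y = x ** y - y ** x"

text \<open>The indices are swapped because \<open>trace (a ** E i j) = a $ j $ i\<close>. Thus
  pairing with this matrix in the trace form gives the functional
  \<open>trace (T x)\<close>.\<close>

definition dual_unit :: "('a::field mat3 \<Rightarrow> 'a mat3) \<Rightarrow> 'a mat3"
  where "dual_unit T = (\<chi> i j. trace (T (E j i)))"

section \<open>Linear maps in coordinates and traces of operators\<close>

lemma mlinear_add: "mlinear T \<Longrightarrow> T (x + y) = T x + T y"
  by (simp add: Vector_Spaces.linear_def module_hom_def module_hom_axioms_def)

lemma mlinear_mscale: "mlinear T \<Longrightarrow> T (mscale c x) = mscale c (T x)"
  by (simp add: Vector_Spaces.linear_def module_hom_def module_hom_axioms_def)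

lemma mlinear_sum: "mlinear T \<Longrightarrow> T (\<Sum>i\<in>A. f i) = (\<Sum>i\<in>A. T (f i))"
  by (rule module_hom.sum[of mscale mscale]) (simp add: Vector_Spaces.linear_def)

lemma mlinear_minus: "mlinear T \<Longrightarrow> T (- x) = - T x"
  by (rule module_hom.neg[of mscale mscale]) (simp add: Vector_Spaces.linear_def)

lemma mlinear_diff: "mlinear T \<Longrightarrow> T (x - y) = T x - T y"
  by (rule module_hom.diff[of mscale mscale]) (simp add: Vector_Spaces.linear_def)

lemma mlinear_compose: "mlinear S \<Longrightarrow> mlinear T \<Longrightarrow> mlinear (\<lambda>x. S (T x))"
  by (rule mlinearI) (simp_all add: mlinear_add mlinear_mscale)

lemma mlinear_mult: "mlinear (\<lambda>x. a ** x)" "mlinear (\<lambda>x. x ** a)"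
  by (rule mlinearI; simp add: mscale_def vec_eq_iff matrix_matrix_mult_def sum_3 algebra_simps)+

lemma mlinear_bracket: "mlinear (bracket a)"
  by (rule mlinearI)
    (simp_all add: bracket_def mscale_def vec_eq_iff matrix_matrix_mult_def sum_3 algebra_simps)

lemma mat3_expand: "x = (\<Sum>k\<in>UNIV. \<Sum>l\<in>UNIV. mscale (x $ k $ l) (E k l))"
  by (simp add: vec_eq_iff mscale_def E_def sum_3 forall_3)

lemma mlinear_entry:
  assumes "mlinear T"
  shows "T x $ i $ j = (\<Sum>k\<in>UNIV. \<Sum>l\<in>UNIV. x $ k $ l * T (E k l) $ i $ j)"
proof -
  have "T x = (\<Sum>k\<in>UNIV. \<Sum>l\<in>UNIV. mscale (x $ k $ l) (T (E k l)))"
    by (subst mat3_expand[of x]) (simp add: assms mlinear_sum mlinear_mscale)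
  then show ?thesis by (simp add: mscale_def)
qed

text \<open>Both traces are the same sum of products of matrix coefficients of \<open>S\<close> and
  \<open>T\<close>, taken in two orders of summation.\<close>

lemma op_trace_commute:
  assumes "mlinear S" "mlinear T"
  shows "op_trace (\<lambda>x. S (T x)) = op_trace (\<lambda>x. T (S x))"
proof -
  have "op_trace (\<lambda>x. S (T x)) = (\<Sum>i\<in>UNIV. \<Sum>j\<in>UNIV. \<Sum>k\<in>UNIV. \<Sum>l\<in>UNIV.
      T (E i j) $ k $ l * S (E k l) $ i $ j)"
    unfolding op_trace_def by (subst mlinear_entry[OF assms(1)]) simp
  also have "\<dots> = (\<Sum>k\<in>UNIV. \<Sum>l\<in>UNIV. \<Sum>i\<in>UNIV. \<Sum>j\<in>UNIV.
      S (E k l) $ i $ j * T (E i j) $ k $ l)"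
    by (simp add: sum_3 algebra_simps)
  also have "\<dots> = op_trace (\<lambda>x. T (S x))"
    unfolding op_trace_def by (subst mlinear_entry[OF assms(2)]) simp
  finally show ?thesis .
qed

lemma op_trace_uminus: "op_trace (\<lambda>x. - T x) = - op_trace T"
  by (simp add: op_trace_def sum_negf)

text \<open>Left multiplication by \<open>a\<close> acts separately on the three columns, right
  multiplication on the three rows; each contributes \<open>trace a\<close>.\<close>

lemma op_trace_mult: "op_trace (\<lambda>x. a ** x) = 3 * trace a" "op_trace (\<lambda>x. x ** a) = 3 * trace a"
  by (simp_all add: op_trace_def trace_def E_def matrix_matrix_mult_def sum_3)

section \<open>Multiplicative and antimultiplicative bijections\<close>

lemma alg_symmetry_cases [consumes 1, case_names mult anti]:
  assumes "alg_symmetry \<psi>"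
    and "(\<And>x y. \<psi> (x ** y) = \<psi> x ** \<psi> y) \<Longrightarrow> P"
    and "(\<And>x y. \<psi> (x ** y) = \<psi> y ** \<psi> x) \<Longrightarrow> P"
  shows P
  using assms by (auto simp: alg_symmetry_def)

context
  fixes \<psi> :: "'a::field mat3 \<Rightarrow> 'a mat3"
  assumes sym: "alg_symmetry \<psi>"
begin

lemma alg_symmetry_inv: "inv_into UNIV \<psi> (\<psi> x) = x" "\<psi> (inv_into UNIV \<psi> x) = x"
  using sym by (auto simp: alg_symmetry_def bij_def surj_f_inv_f)

lemma alg_symmetry_linear: "mlinear \<psi>" "mlinear (inv_into UNIV \<psi>)"
proof -
  show l: "mlinear \<psi>" using sym by (simp add: alg_symmetry_def)
  show "mlinear (inv_into UNIV \<psi>)"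
    by (rule mlinearI)
      (metis alg_symmetry_inv l mlinear_add, metis alg_symmetry_inv l mlinear_mscale)
qed

lemma alg_symmetry_inverse: "alg_symmetry (inv_into UNIV \<psi>)"
proof -
  have "bij (inv_into UNIV \<psi>)" using sym by (simp add: alg_symmetry_def bij_imp_bij_inv)
  moreover have "(\<forall>x y. inv_into UNIV \<psi> (x ** y) = inv_into UNIV \<psi> x ** inv_into UNIV \<psi> y) \<or>
      (\<forall>x y. inv_into UNIV \<psi> (x ** y) = inv_into UNIV \<psi> y ** inv_into UNIV \<psi> x)"
    by (cases rule: alg_symmetry_cases[OF sym]) (metis alg_symmetry_inv)+
  ultimately show ?thesis
    using alg_symmetry_linear(2) by (simp add: alg_symmetry_def)
qed

text \<open>\<open>T'\<close> is the conjugate of \<open>T\<close> by \<open>\<psi>\<close>, so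
  cyclicity of the trace lets \<open>\<psi>\<close> cancel against its inverse.\<close>

lemma op_trace_conj:
  assumes "mlinear T" "\<And>x. \<psi> (T' x) = T (\<psi> x)"
  shows "op_trace T' = op_trace T"
proof -
  have "T' = (\<lambda>x. inv_into UNIV \<psi> (T (\<psi> x)))"
    by (metis assms(2) alg_symmetry_inv(1))
  then have "op_trace T' = op_trace (\<lambda>x. T (\<psi> (inv_into UNIV \<psi> x)))"
    using op_trace_commute[OF alg_symmetry_linear(2) mlinear_compose[OF assms(1) alg_symmetry_linear(1)]]
    by simp
  then show ?thesis by (simp add: alg_symmetry_inv)
qed

text \<open>Reversing products turns a commutator into its negative. This sign is why a trace is
  squared in \<open>rb_code\<close>.\<close>

lemma alg_symmetry_bracket:
  "(\<forall>x y. \<psi> (bracket x y) = bracket (\<psi> x) (\<psi> y)) \<or>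
    (\<forall>x y. \<psi> (bracket x y) = - bracket (\<psi> x) (\<psi> y))"
  by (cases rule: alg_symmetry_cases[OF sym])
    (simp_all add: bracket_def mlinear_diff[OF alg_symmetry_linear(1)])

end

text \<open>No appeal to the Skolem--Noether theorem is needed: up to the factor 3, the trace of a matrix
  is the trace of the left multiplication by it.\<close>

lemma trace_alg_symmetry:
  fixes a :: "'a::field_char_0 mat3"
  assumes "alg_symmetry \<psi>"
  shows "trace (\<psi> a) = trace a"
  using assms
proof (cases rule: alg_symmetry_cases)
  case mult
  then have "op_trace (\<lambda>x. a ** x) = op_trace (\<lambda>x. \<psi> a ** x)"
    by (intro op_trace_conj[OF assms] mlinear_mult)
  then show ?thesis by (simp add: op_trace_mult)
next
  case anti
  then have "op_trace (\<lambda>x. a ** x) = op_trace (\<lambda>x. x ** \<psi> a)"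
    by (intro op_trace_conj[OF assms] mlinear_mult)
  then show ?thesis by (simp add: op_trace_mult)
qed

section \<open>Duality with respect to the trace form\<close>

lemma trace_dual_unit:
  assumes "mlinear T"
  shows "trace (dual_unit T ** x) = trace (T x)"
proof -
  have "trace (T x) = (\<Sum>k\<in>UNIV. \<Sum>l\<in>UNIV. x $ k $ l * trace (T (E k l)))"
    unfolding trace_def by (subst mlinear_entry[OF assms]) (simp add: sum_3 algebra_simps)
  then show ?thesis
    by (simp add: dual_unit_def trace_def matrix_matrix_mult_def sum_3 algebra_simps)
qed

text \<open>This gives nondegeneracy of the trace form: pairing with matrix units recovers every
  entry.\<close>

lemma trace_mult_E: "trace (a ** E i j) = a $ j $ i"
  using exhaust_3[of i] exhaust_3[of j]
  by (auto simp: trace_def matrix_matrix_mult_def E_def sum_3)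

text \<open>Since \<open>\<psi>\<close> preserves traces and the trace form, both matrices represent
  the same functional, and nondegeneracy makes them equal.\<close>

lemma dual_unit_conj:
  fixes T :: "'a::field_char_0 mat3 \<Rightarrow> 'a mat3"
  assumes "alg_symmetry \<psi>" "mlinear T" "mlinear T'" "\<And>x. \<psi> (T' x) = T (\<psi> x)"
  shows "\<psi> (dual_unit T') = dual_unit T"
proof -
  \<comment> \<open>In the antimultiplicative case the two factors come out in reverse order, which
    the trace does not see.\<close>
  have "trace (\<psi> (dual_unit T') ** \<psi> x) = trace (dual_unit T' ** x)" for x
    by (cases rule: alg_symmetry_cases[OF assms(1)])
      (metis trace_alg_symmetry[OF assms(1)], metis trace_alg_symmetry[OF assms(1)] trace_mul_sym)
  then have "trace (\<psi> (dual_unit T') ** \<psi> x) = trace (dual_unit T ** \<psi> x)" for x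
    by (simp add: trace_dual_unit assms(2,3) flip: assms(4) trace_alg_symmetry[OF assms(1), of "T' x"])
  then have "trace (\<psi> (dual_unit T') ** x) = trace (dual_unit T ** x)" for x
    by (metis alg_symmetry_inv(2)[OF assms(1)])
  then show ?thesis
    by (metis trace_mult_E vec_eq_iff)
qed


section \<open>Invariants of orbits\<close>

definition op_sim :: "('a::field mat3 \<Rightarrow> 'a mat3) \<Rightarrow> ('a mat3 \<Rightarrow> 'a mat3) \<Rightarrow> bool"
  where "op_sim R S \<longleftrightarrow> (\<exists>\<psi>. alg_symmetry \<psi> \<and>
    ((\<forall>x. \<psi> (S x) = R (\<psi> x)) \<or> (\<forall>x. \<psi> (S x) = phi_op R (\<psi> x))))"

lemma phi_op_phi_op [simp]: "phi_op (phi_op R) = R"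
  by (simp add: phi_op_def)

text \<open>The map \<open>phi_op\<close> commutes with conjugation by linear bijections, so it can
  be moved across \<open>\<psi>\<close> and any word in the generators needs at most one of
  it.\<close>

lemma phi_op_intertwine:
  assumes "mlinear \<psi>" "\<And>x. \<psi> (S x) = R (\<psi> x)"
  shows "\<psi> (phi_op S x) = phi_op R (\<psi> x)"
  using assms by (simp add: phi_op_def mlinear_minus mlinear_diff)

lemma alg_symmetry_id: "alg_symmetry (\<lambda>x. x)"
  by (auto simp: alg_symmetry_def bij_def intro: mlinearI)

lemma alg_symmetry_compose:
  assumes "alg_symmetry \<psi>" "alg_symmetry \<eta>"
  shows "alg_symmetry (\<lambda>x. \<eta> (\<psi> x))"
proof -
  have "bij (\<lambda>x. \<eta> (\<psi> x))"
    using assms bij_comp[of \<psi> \<eta>] by (simp add: alg_symmetry_def comp_def)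
  moreover have "mlinear (\<lambda>x. \<eta> (\<psi> x))"
    using assms by (simp add: alg_symmetry_def mlinear_compose)
  ultimately show ?thesis
    using assms unfolding alg_symmetry_def by auto
qed

lemma op_sim_sym:
  assumes "op_sim R S"
  shows "op_sim S R"
proof -
  obtain \<psi> where \<psi>: "alg_symmetry \<psi>" and
    d: "(\<forall>x. \<psi> (S x) = R (\<psi> x)) \<or> (\<forall>x. \<psi> (S x) = phi_op R (\<psi> x))"
    using assms by (auto simp: op_sim_def)
  note i = alg_symmetry_inv[OF \<psi>] and l = alg_symmetry_linear(1)[OF \<psi>]
  \<comment> \<open>Applying \<open>phi_op\<close> to both sides of the second alternative moves it
    from \<open>R\<close> to \<open>S\<close>, because it is an involution.\<close>
  from d have "(\<forall>x. \<psi> (S x) = R (\<psi> x)) \<or> (\<forall>x. \<psi> (phi_op S x) = R (\<psi> x))"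
    using phi_op_intertwine[OF l, of S "phi_op R"] by auto
  then have "(\<forall>x. inv_into UNIV \<psi> (R x) = S (inv_into UNIV \<psi> x)) \<or>
      (\<forall>x. inv_into UNIV \<psi> (R x) = phi_op S (inv_into UNIV \<psi> x))"
    by (metis i)
  then show ?thesis
    using alg_symmetry_inverse[OF \<psi>] by (auto simp: op_sim_def)
qed

lemma op_sim_trans:
  assumes "op_sim R S" "op_sim S T"
  shows "op_sim R T"
proof -
  obtain \<psi> where \<psi>: "alg_symmetry \<psi>" and
    d: "(\<forall>x. \<psi> (S x) = R (\<psi> x)) \<or> (\<forall>x. \<psi> (S x) = phi_op R (\<psi> x))"
    using assms(1) by (auto simp: op_sim_def)
  obtain \<eta> where \<eta>: "alg_symmetry \<eta>" and
    e: "(\<forall>x. \<eta> (T x) = S (\<eta> x)) \<or> (\<forall>x. \<eta> (T x) = phi_op S (\<eta> x))"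
    using assms(2) by (auto simp: op_sim_def)
  note l = alg_symmetry_linear(1)[OF \<psi>]
  have "(\<forall>x. \<psi> (phi_op S x) = phi_op R (\<psi> x)) \<or> (\<forall>x. \<psi> (phi_op S x) = R (\<psi> x))"
    using d phi_op_intertwine[OF l, of S R] phi_op_intertwine[OF l, of S "phi_op R"] by auto
  with d e have "(\<forall>x. \<psi> (\<eta> (T x)) = R (\<psi> (\<eta> x))) \<or> (\<forall>x. \<psi> (\<eta> (T x)) = phi_op R (\<psi> (\<eta> x)))"
    using phi_op_intertwine[OF l, of S R] phi_op_intertwine[OF l, of S "phi_op R"] by auto
  then show ?thesis
    using alg_symmetry_compose[OF \<eta> \<psi>] unfolding op_sim_def by blast
qed

lemma op_sim_generator:
  assumes "g \<in> action_generators"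
  shows "op_sim R (g R)"
proof -
  consider "g = phi_op" | \<psi> where "g = conj_aut \<psi>" "algebra_automorphism \<psi>" | "g = conj_transpose"
    using assms by (auto simp: action_generators_def)
  then show ?thesis
  proof cases
    case 1
    then show ?thesis using alg_symmetry_id by (auto simp: op_sim_def)
  next
    case 2
    then have \<psi>: "alg_symmetry \<psi>" by (auto simp: algebra_automorphism_def alg_symmetry_def)
    then show ?thesis
      using 2 alg_symmetry_inv[OF \<psi>] by (auto simp: op_sim_def conj_aut_def)
  next
    case 3
    have "alg_symmetry (Finite_Cartesian_Product.transpose :: 'a mat3 \<Rightarrow> 'a mat3)"
      unfolding alg_symmetry_def
    proof (intro conjI disjI2 allI)
      show "mlinear (Finite_Cartesian_Product.transpose :: 'a mat3 \<Rightarrow> 'a mat3)"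
        by (rule mlinearI) (simp_all add: Finite_Cartesian_Product.transpose_def mscale_def vec_eq_iff)
      show "bij (Finite_Cartesian_Product.transpose :: 'a mat3 \<Rightarrow> 'a mat3)"
        by (rule o_bij[of Finite_Cartesian_Product.transpose]) (auto simp: fun_eq_iff)
    qed (rule matrix_transpose_mul)
    then show ?thesis
      using 3 by (auto simp: op_sim_def conj_transpose_def)
  qed
qed

text \<open>Induction over the generated group: products are covered by transitivity of
  \<open>op_sim\<close>, inverses of generators by its symmetry.\<close>

lemma op_sim_orbit:
  assumes "S \<in> rb_orbit R"
  shows "op_sim R S"
proof -
  interpret B: group "BijGroup (UNIV :: ('a mat3 \<Rightarrow> 'a mat3) set)"
    by (rule group_BijGroup)
  let ?B = "BijGroup (UNIV :: ('a mat3 \<Rightarrow> 'a mat3) set)"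
  have *: "op_sim R (g R)" if "g \<in> generate ?B action_generators" for g R
    using that
  proof (induction g arbitrary: R rule: generate.induct)
    case one
    show ?case using alg_symmetry_id by (auto simp: op_sim_def BijGroup_def)
  next
    case (incl h)
    then show ?case by (rule op_sim_generator)
  next
    case (inv h)
    then have h: "h \<in> carrier ?B" using action_generators_subset by blast
    have "h \<otimes>\<^bsub>?B\<^esub> inv\<^bsub>?B\<^esub> h = \<one>\<^bsub>?B\<^esub>" using h by simp
    moreover have "inv\<^bsub>?B\<^esub> h \<in> carrier ?B" using h by simp
    \<comment> \<open>So \<open>R\<close> is the image under the generator \<open>h\<close> of the
      operator obtained from \<open>R\<close> by the inverse of \<open>h\<close>.\<close>
    ultimately have "h ((inv\<^bsub>?B\<^esub> h) R) = R"
      using h by (auto simp: BijGroup_def compose_def fun_eq_iff restrict_def)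
    then show ?case
      using op_sim_generator[OF inv, of "(inv\<^bsub>?B\<^esub> h) R"] op_sim_sym by metis
  next
    case (eng h1 h2)
    then have "h1 \<in> carrier ?B" "h2 \<in> carrier ?B"
      using B.generate_in_carrier action_generators_subset by blast+
    then have "(h1 \<otimes>\<^bsub>?B\<^esub> h2) R = h1 (h2 R)"
      by (simp add: BijGroup_def compose_def)
    then show ?case using eng.IH op_sim_trans by metis
  qed
  \<comment> \<open>\<open>subgroup_generated\<close> intersects the generating set with the
    carrier; here that intersection changes nothing.\<close>
  have "carrier action_group = generate ?B (action_generators :: (('a mat3 \<Rightarrow> 'a mat3) \<Rightarrow> _) set)"
    unfolding action_group_def carrier_subgroup_generated
    by (rule arg_cong[where f = "generate ?B"]) (use action_generators_subset in blast)
  then show ?thesis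
    using assms * by (auto simp: rb_orbit_def orbit_def)
qed

lemma mem_rb_orbit: "R \<in> rb_orbit R"
proof -
  have "(\<lambda>x. x) \<in> carrier action_group"
    using generate.one[of "BijGroup UNIV"]
    by (auto simp: action_group_def carrier_subgroup_generated BijGroup_def restrict_def)
  then show ?thesis by (force simp: rb_orbit_def orbit_def)
qed

section \<open>The invariants and their behaviour under symmetries\<close>

definition sym_op :: "('a::field mat3 \<Rightarrow> 'a mat3) \<Rightarrow> ('a mat3 \<Rightarrow> 'a mat3)"
  where "sym_op R x = R x - phi_op R x"

text \<open>When \<open>q\<close> changes sign, \<open>s\<close> and \<open>z\<close> change sign
  while \<open>y\<close> does not, so each entry involves an even number of signs or an equation
  negated on both sides. The square absorbs the sign that an antimultiplicative map puts on
  brackets.\<close>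

definition rb_code :: "('a::field mat3 \<Rightarrow> 'a mat3) \<Rightarrow> 'a \<times> 'a \<times> bool"
  where "rb_code R = (let q = sym_op R; s = dual_unit q; y = q s; z = q y in
    (op_trace q * trace s, (op_trace (\<lambda>x. q (bracket z x)))\<^sup>2,
     \<forall>x. q (bracket y x) = bracket y (q x)))"

text \<open>The form is symmetric under reversal of products, so it survives antimultiplicative
  maps. It is a condition on \<open>R\<close> alone and may differ for
  \<open>phi_op R\<close>.\<close>

definition comm_annihilated :: "('a::field mat3 \<Rightarrow> 'a mat3) \<Rightarrow> bool"
  where "comm_annihilated R \<longleftrightarrow> (\<forall>x y z w. R z ** bracket (R x) (R y) ** R w = 0)"

lemma mlinear_phi_op: "mlinear R \<Longrightarrow> mlinear (phi_op R)"
  by (rule mlinearI)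
    (simp_all add: phi_op_def mlinear_add mlinear_mscale mat3.scale_right_distrib
      mat3.scale_right_diff_distrib)

lemma mlinear_sym_op: "mlinear R \<Longrightarrow> mlinear (sym_op R)"
  using mlinear_phi_op[of R]
  by (intro mlinearI) (simp_all add: sym_op_def mlinear_add mlinear_mscale mat3.scale_right_diff_distrib)

lemma sym_op_phi_op: "sym_op (phi_op R) = (\<lambda>x. - sym_op R x)"
  by (simp add: sym_op_def fun_eq_iff)

lemma bracket_uminus: "bracket (- x) y = - bracket x y" "bracket x (- y) = - bracket x y"
  by (simp_all add: bracket_def matrix_matrix_mult_def vec_eq_iff sum_negf)

lemma rb_code_phi_op:
  assumes "mlinear R"
  shows "rb_code (phi_op R) = rb_code R"
proof -
  have s: "dual_unit (\<lambda>x. - T x) = - dual_unit T" for T :: "'a mat3 \<Rightarrow> 'a mat3"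
    by (simp add: dual_unit_def trace_def vec_eq_iff sum_negf)
  have "trace (- x) = - trace x" for x :: "'a mat3"
    by (simp add: trace_def sum_negf)
  then show ?thesis
    using mlinear_minus[OF mlinear_sym_op[OF assms]]
    by (simp add: rb_code_def Let_def sym_op_phi_op s op_trace_uminus bracket_uminus)
qed

text \<open>The map \<open>\<psi>\<close> intertwines the two operators \<open>q\<close> and carries
  \<open>s\<close>, hence also \<open>y\<close> and \<open>z\<close>, of one to those of the
  other.\<close>

lemma rb_code_conj:
  fixes R :: "'a::field_char_0 mat3 \<Rightarrow> 'a mat3"
  assumes "alg_symmetry \<psi>" "mlinear R" "mlinear S" "\<And>x. \<psi> (S x) = R (\<psi> x)"
  shows "rb_code S = rb_code R"
proof -
  define q where "q = sym_op R"
  define p where "p = sym_op S"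
  note lin = alg_symmetry_linear(1)[OF assms(1)]
  note inv = alg_symmetry_inv[OF assms(1)]
  have lq: "mlinear q" "mlinear p"
    using assms by (simp_all add: q_def p_def mlinear_sym_op)
  have pq: "\<psi> (p x) = q (\<psi> x)" for x
    using assms(4) phi_op_intertwine[of \<psi> S R, OF lin assms(4)]
    by (simp add: p_def q_def sym_op_def mlinear_diff[OF lin])
  have s: "\<psi> (dual_unit p) = dual_unit q"
    by (rule dual_unit_conj[OF assms(1) lq pq])
  have ts: "trace (dual_unit p) = trace (dual_unit q)"
    by (metis s trace_alg_symmetry[OF assms(1)])
  have tq: "op_trace p = op_trace q"
    by (rule op_trace_conj[OF assms(1) lq(1) pq])
  let ?z = "\<lambda>q. q (q (dual_unit q))"
  have l1: "mlinear (\<lambda>x. q (bracket a x))" for a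
    by (rule mlinear_compose[OF lq(1) mlinear_bracket])
  from alg_symmetry_bracket[OF assms(1)]
  have "(op_trace (\<lambda>x. p (bracket (?z p) x)))\<^sup>2 = (op_trace (\<lambda>x. q (bracket (?z q) x)))\<^sup>2 \<and>
    (\<forall>x. p (bracket (p (dual_unit p)) x) = bracket (p (dual_unit p)) (p x)) =
    (\<forall>x. q (bracket (q (dual_unit q)) x) = bracket (q (dual_unit q)) (q x))"
  proof
    assume b: "\<forall>x y. \<psi> (bracket x y) = bracket (\<psi> x) (\<psi> y)"
    have "op_trace (\<lambda>x. p (bracket (?z p) x)) = op_trace (\<lambda>x. q (bracket (?z q) x))"
      by (rule op_trace_conj[OF assms(1) l1]) (simp add: pq b s)
    moreover have "p (bracket (p (dual_unit p)) x) = bracket (p (dual_unit p)) (p x) \<longleftrightarrow>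
        q (bracket (q (dual_unit q)) (\<psi> x)) = bracket (q (dual_unit q)) (q (\<psi> x))" for x
      by (metis inv(1) b pq s)
    \<comment> \<open>Surjectivity of \<open>\<psi>\<close> turns the condition at all
      \<open>\<psi> x\<close> into the condition at all matrices.\<close>
    ultimately show ?thesis by (metis inv(2))
  next
    assume b: "\<forall>x y. \<psi> (bracket x y) = - bracket (\<psi> x) (\<psi> y)"
    \<comment> \<open>The sign of the bracket is moved onto \<open>z\<close>, so that the operator
      on the right is again a composition to which \<open>op_trace_conj\<close> applies.\<close>
    have "op_trace (\<lambda>x. p (bracket (?z p) x)) = op_trace (\<lambda>x. q (bracket (- ?z q) x))"
      by (rule op_trace_conj[OF assms(1) l1]) (simp add: pq b s bracket_uminus)
    then have "op_trace (\<lambda>x. p (bracket (?z p) x)) = - op_trace (\<lambda>x. q (bracket (?z q) x))"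
      by (simp add: bracket_uminus mlinear_minus[OF lq(1)] op_trace_uminus)
    moreover have "p (bracket (p (dual_unit p)) x) = bracket (p (dual_unit p)) (p x) \<longleftrightarrow>
        q (bracket (q (dual_unit q)) (\<psi> x)) = bracket (q (dual_unit q)) (q (\<psi> x))" for x
    proof -
      have "p (bracket (p (dual_unit p)) x) = bracket (p (dual_unit p)) (p x) \<longleftrightarrow>
        \<psi> (p (bracket (p (dual_unit p)) x)) = \<psi> (bracket (p (dual_unit p)) (p x))"
        by (metis inv(1))
      then show ?thesis by (simp add: pq b s mlinear_minus[OF lq(1)])
    qed
    ultimately show ?thesis by (simp add: power2_eq_square) (metis inv(2))
  qed
  then show ?thesis
    using ts tq by (simp add: rb_code_def Let_def flip: p_def q_def)
qed

lemma comm_annihilated_conj: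
  assumes "alg_symmetry \<psi>" "\<And>x. \<psi> (S x) = R (\<psi> x)" "comm_annihilated R"
  shows "comm_annihilated S"
  unfolding comm_annihilated_def
proof (intro allI)
  fix x y z w
  note lin = alg_symmetry_linear(1)[OF assms(1)]
  have 0: "\<psi> 0 = 0" using mlinear_mscale[OF lin, of 0 0] by simp
  have R: "R z ** bracket (R x) (R y) ** R w = 0" for x y z w
    using assms(3) by (simp add: comm_annihilated_def)
  have "\<psi> (S z ** bracket (S x) (S y) ** S w) = 0"
    using assms(1)
  proof (cases rule: alg_symmetry_cases)
    case mult
    then show ?thesis using R by (simp add: bracket_def mlinear_diff[OF lin] assms(2))
  next
    case anti
    \<comment> \<open>Reversal exchanges the outer factors and also the two arguments of the
      bracket.\<close>
    then show ?thesis using R[of "\<psi> w" "\<psi> y" "\<psi> x" "\<psi> z"]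
      by (simp add: bracket_def mlinear_diff[OF lin] assms(2) matrix_mul_assoc)
  qed
  then show "S z ** bracket (S x) (S y) ** S w = 0"
    by (metis 0 alg_symmetry_inv(1)[OF assms(1)])
qed

lemma rb_code_orbit:
  fixes R S :: "'a::field_char_0 mat3 \<Rightarrow> 'a mat3"
  assumes "mlinear R" "mlinear S" "rb_orbit R = rb_orbit S"
  shows "rb_code R = rb_code S"
proof -
  have "op_sim R S" using assms(3) mem_rb_orbit[of S] op_sim_orbit by metis
  then show ?thesis
    using rb_code_conj rb_code_phi_op[OF assms(1)] mlinear_phi_op[OF assms(1)] assms(1,2)
    unfolding op_sim_def by metis
qed

text \<open>To exclude the property on a whole orbit it suffices to refute it for \<open>R\<close>
  and \<open>phi_op R\<close>.\<close>

lemma comm_annihilated_orbit: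
  assumes "S \<in> rb_orbit R" "comm_annihilated S"
  shows "comm_annihilated R \<or> comm_annihilated (phi_op R)"
proof -
  have "op_sim S R" using assms(1) op_sim_orbit op_sim_sym by metis
  then obtain \<psi> where \<psi>: "alg_symmetry \<psi>" and
    d: "(\<forall>x. \<psi> (R x) = S (\<psi> x)) \<or> (\<forall>x. \<psi> (R x) = phi_op S (\<psi> x))"
    by (auto simp: op_sim_def)
  have "(\<forall>x. \<psi> (R x) = S (\<psi> x)) \<or> (\<forall>x. \<psi> (phi_op R x) = S (\<psi> x))"
    using d phi_op_intertwine[OF alg_symmetry_linear(1)[OF \<psi>], of R "phi_op S"] by auto
  then show ?thesis
    using comm_annihilated_conj[OF \<psi> _ assms(2)] by blast
qed


section \<open>Evaluation on the 36 operators\<close>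

definition mat33 :: "'a \<Rightarrow> 'a \<Rightarrow> 'a \<Rightarrow> 'a \<Rightarrow> 'a \<Rightarrow> 'a \<Rightarrow> 'a \<Rightarrow> 'a \<Rightarrow> 'a \<Rightarrow> 'a::field mat3"
  where "mat33 a b c d e f g h i = vector [vector [a, b, c], vector [d, e, f], vector [g, h, i]]"

lemma mat33_entry [simp]:
  "mat33 a b c d e f g h i $ 1 $ 1 = a" "mat33 a b c d e f g h i $ 1 $ 2 = b"
  "mat33 a b c d e f g h i $ 1 $ 3 = c" "mat33 a b c d e f g h i $ 2 $ 1 = d"
  "mat33 a b c d e f g h i $ 2 $ 2 = e" "mat33 a b c d e f g h i $ 2 $ 3 = f"
  "mat33 a b c d e f g h i $ 3 $ 1 = g" "mat33 a b c d e f g h i $ 3 $ 2 = h"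
  "mat33 a b c d e f g h i $ 3 $ 3 = i"
  by (simp_all add: mat33_def)

lemma mat33_cases: obtains a b c d e f g h i where "x = mat33 a b c d e f g h i"
proof
  show "x = mat33 (x $ 1 $ 1) (x $ 1 $ 2) (x $ 1 $ 3) (x $ 2 $ 1) (x $ 2 $ 2) (x $ 2 $ 3)
      (x $ 3 $ 1) (x $ 3 $ 2) (x $ 3 $ 3)"
    by (simp add: vec_eq_iff forall_3)
qed

lemma mat33_eq_iff [simp]:
  "mat33 a b c d e f g h i = mat33 a' b' c' d' e' f' g' h' i' \<longleftrightarrow>
    a = a' \<and> b = b' \<and> c = c' \<and> d = d' \<and> e = e' \<and> f = f' \<and> g = g' \<and> h = h' \<and> i = i'"
  by (auto simp: vec_eq_iff forall_3)

lemma mat33_simps: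
  "mat33 a b c d e f g h i + mat33 a' b' c' d' e' f' g' h' i' =
    mat33 (a + a') (b + b') (c + c') (d + d') (e + e') (f + f') (g + g') (h + h') (i + i')"
  "mat33 a b c d e f g h i - mat33 a' b' c' d' e' f' g' h' i' =
    mat33 (a - a') (b - b') (c - c') (d - d') (e - e') (f - f') (g - g') (h - h') (i - i')"
  "- mat33 a b c d e f g h i = mat33 (- a) (- b) (- c) (- d) (- e) (- f) (- g) (- h) (- i)"
  "mscale k (mat33 a b c d e f g h i) =
    mat33 (k * a) (k * b) (k * c) (k * d) (k * e) (k * f) (k * g) (k * h) (k * i)"
  "mat33 a b c d e f g h i ** mat33 a' b' c' d' e' f' g' h' i' =
    mat33 (a * a' + b * d' + c * g') (a * b' + b * e' + c * h') (a * c' + b * f' + c * i')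
      (d * a' + e * d' + f * g') (d * b' + e * e' + f * h') (d * c' + e * f' + f * i')
      (g * a' + h * d' + i * g') (g * b' + h * e' + i * h') (g * c' + h * f' + i * i')"
  "trace (mat33 a b c d e f g h i) = a + e + i"
  by (simp_all add: vec_eq_iff forall_3 mscale_def matrix_matrix_mult_def sum_3 trace_def)

lemma mat33_0: "(0 :: 'a::field mat3) = mat33 0 0 0 0 0 0 0 0 0"
  by (simp add: vec_eq_iff forall_3)

lemma mat33_E:
  "E 1 1 = mat33 1 0 0 0 0 0 0 0 0"
  "E 1 2 = mat33 0 1 0 0 0 0 0 0 0"
  "E 1 3 = mat33 0 0 1 0 0 0 0 0 0"
  "E 2 1 = mat33 0 0 0 1 0 0 0 0 0"
  "E 2 2 = mat33 0 0 0 0 1 0 0 0 0"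
  "E 2 3 = mat33 0 0 0 0 0 1 0 0 0"
  "E 3 1 = mat33 0 0 0 0 0 0 1 0 0"
  "E 3 2 = mat33 0 0 0 0 0 0 0 1 0"
  "E 3 3 = mat33 0 0 0 0 0 0 0 0 1"
  by (simp_all add: vec_eq_iff forall_3 E_def)

lemma dual_unit_mat33: "dual_unit T = mat33
    (trace (T (E 1 1))) (trace (T (E 2 1))) (trace (T (E 3 1)))
    (trace (T (E 1 2))) (trace (T (E 2 2))) (trace (T (E 3 2)))
    (trace (T (E 1 3))) (trace (T (E 2 3))) (trace (T (E 3 3)))"
  by (simp add: dual_unit_def vec_eq_iff forall_3)

lemma \<Phi>_mat33:
  "\<Phi> 1 2 (mat33 a b c d e f g h i) = mat33 e d f b a c h g i"
  "\<Phi> 2 3 (mat33 a b c d e f g h i) = mat33 a c b g i h d f e"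
  by (simp_all add: \<Phi>_def vec_eq_iff forall_3 Transposition.transpose_def)

lemma inv_\<Phi>: "inv_into UNIV (\<Phi> a b) = \<Phi> a b"
  by (rule inv_equality) (simp_all add: \<Phi>_def vec_eq_iff)

lemmas rho_defs = rho1_def rho2_def rho3_def rho4_def rho5_def rho6_def rho7_def diag_op_def
lemmas primitive_defs = op_a_def op_b_def op_c_def primitive_def conj_aut_def diag_part_def lower_part_def
lemmas lin_op_defs = lin_op_def lin_op_C_def
  op_1_I_def op_6_I_def op_6_II_def op_6_III_def op_2_I_def op_2_II_def
  op_3_I_def op_3_II_def op_4_I_def op_4_II_def op_5_I_def op_5_II_def
  op_6_IV_def op_6_V_def op_6_VI_def op_8_I_def

text \<open>There is no row for \<open>op_c rho5\<close>: as \<open>rho5\<close> is symmetric in the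
  indices 2 and 3, it would repeat \<open>op_a rho5\<close>.\<close>

lemma primitive_mat33:
  "op_a rho1 (mat33 a b c d e f g h i) =
    mat33 0 0 0 (- d) a 0 (- g) (- h) (a + e)"
  "op_a rho2 (mat33 a b c d e f g h i) =
    mat33 0 0 0 (- d) a 0 (- g) (- h) (a + e - i)"
  "op_a rho3 (mat33 a b c d e f g h i) =
    mat33 0 0 0 (- d) (a - e) 0 (- g) (- h) (a - e - i)"
  "op_a rho4 (mat33 a b c d e f g h i) =
    mat33 0 0 0 (- d) (a - e) 0 (- g) (- h) a"
  "op_a rho5 (mat33 a b c d e f g h i) =
    mat33 0 0 0 (- d) a 0 (- g) (- h) a"
  "op_a rho6 (mat33 a b c d e f g h i) =
    mat33 0 0 0 (- d) a 0 (- g) (- h) 0"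
  "op_a rho7 (mat33 a b c d e f g h i) =
    mat33 0 0 0 (- d) a 0 (- g) (- h) (- i)"
  "op_b rho1 (mat33 a b c d e f g h i) =
    mat33 e 0 0 (- d) 0 0 (- g) (- h) (a + e)"
  "op_b rho2 (mat33 a b c d e f g h i) =
    mat33 e 0 0 (- d) 0 0 (- g) (- h) (a + e - i)"
  "op_b rho3 (mat33 a b c d e f g h i) =
    mat33 (- a + e) 0 0 (- d) 0 0 (- g) (- h) (- a + e - i)"
  "op_b rho4 (mat33 a b c d e f g h i) =
    mat33 (- a + e) 0 0 (- d) 0 0 (- g) (- h) e"
  "op_b rho5 (mat33 a b c d e f g h i) =
    mat33 e 0 0 (- d) 0 0 (- g) (- h) e"
  "op_b rho6 (mat33 a b c d e f g h i) =
    mat33 e 0 0 (- d) 0 0 (- g) (- h) 0"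
  "op_b rho7 (mat33 a b c d e f g h i) =
    mat33 e 0 0 (- d) 0 0 (- g) (- h) (- i)"
  "op_c rho1 (mat33 a b c d e f g h i) =
    mat33 0 0 0 (- d) (a + i) 0 (- g) (- h) a"
  "op_c rho2 (mat33 a b c d e f g h i) =
    mat33 0 0 0 (- d) (a - e + i) 0 (- g) (- h) a"
  "op_c rho3 (mat33 a b c d e f g h i) =
    mat33 0 0 0 (- d) (a - e - i) 0 (- g) (- h) (a - i)"
  "op_c rho4 (mat33 a b c d e f g h i) =
    mat33 0 0 0 (- d) a 0 (- g) (- h) (a - i)"
  "op_c rho6 (mat33 a b c d e f g h i) =
    mat33 0 0 0 (- d) 0 0 (- g) (- h) a"
  "op_c rho7 (mat33 a b c d e f g h i) =
    mat33 0 0 0 (- d) (- e) 0 (- g) (- h) a"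
  by (simp_all add: primitive_defs rho_defs inv_\<Phi> mat33_E \<Phi>_mat33 mat33_0 mat33_simps)

lemma lin_op_mat33:
  "op_1_I (mat33 a b c d e f g h i) =
    mat33 0 (- b + f) (- c) 0 a (- f) 0 (- d) (a + e)"
  "op_6_I (mat33 a b c d e f g h i) =
    mat33 c (- b) (- c) (- d) (a + c) d (- g) (- b) g"
  "op_6_II (mat33 a b c d e f g h i) =
    mat33 g 0 0 (- d) (a + g) 0 (- g) 0 0"
  "op_6_III (mat33 a b c d e f g h i) =
    mat33 g 0 0 (- d) (a + g) (- d) (- g) 0 0"
  "op_2_I (mat33 a b c d e f g h i) =
    mat33 0 (- b) (- c) 0 a (- f) 0 0 (a + e + h - i)"
  "op_2_II (mat33 a b c d e f g h i) =
    mat33 0 (- b) (- c) 0 a 0 0 (- h) (a + e + f - i)"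
  "op_3_I (mat33 a b c d e f g h i) =
    mat33 (- a - e + h + i) (- b) (- c) 0 (- e + h + i) (- f) 0 0 0"
  "op_3_II (mat33 a b c d e f g h i) =
    mat33 (- a - e + f + i) (- b) (- c) 0 (- e + f + i) 0 0 (- h) 0"
  "op_4_I (mat33 a b c d e f g h i) =
    mat33 e (- b) (- c) 0 0 0 0 (- h) (e + f - i)"
  "op_4_II (mat33 a b c d e f g h i) =
    mat33 e (- b) (- c) 0 0 (- f) 0 0 (e + h - i)"
  "op_5_I (mat33 a b c d e f g h i) =
    mat33 0 (- b) (- c) 0 a 0 0 0 a"
  "op_5_II (mat33 a b c d e f g h i) =
    mat33 0 (- b) (- c) 0 a 0 0 (- h) (a + h)"
  "op_6_IV (mat33 a b c d e f g h i) =
    mat33 (e + f) (- b) (- c) 0 f (- f) 0 0 0"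
  "op_6_V (mat33 a b c d e f g h i) =
    mat33 (e + h) (- b) (- c) 0 h 0 0 (- h) 0"
  "op_6_VI (mat33 a b c d e f g h i) =
    mat33 0 (- b) (- c) 0 a 0 0 0 0"
  "op_8_I (mat33 a b c d e f g h i) =
    mat33 (- a + h) (- b) (- c) 0 h 0 0 (- h) 0"
  by (simp_all add: lin_op_defs mat33_E mat33_0 mat33_simps)

lemmas op_mat33 = primitive_mat33 lin_op_mat33

section \<open>The Rota--Baxter identity\<close>

lemma rota_baxterI_mat33:
  fixes R :: "'a::field mat3 \<Rightarrow> 'a mat3"
  assumes "\<And>a b c d e f g h i a' b' c' d' e' f' g' h' i'.
      R (mat33 a b c d e f g h i + mat33 a' b' c' d' e' f' g' h' i') =
      R (mat33 a b c d e f g h i) + R (mat33 a' b' c' d' e' f' g' h' i')"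
    and "\<And>k a b c d e f g h i.
      R (mscale k (mat33 a b c d e f g h i)) = mscale k (R (mat33 a b c d e f g h i))"
    and "\<And>a b c d e f g h i a' b' c' d' e' f' g' h' i'.
      R (mat33 a b c d e f g h i) ** R (mat33 a' b' c' d' e' f' g' h' i') =
      R (R (mat33 a b c d e f g h i) ** mat33 a' b' c' d' e' f' g' h' i' +
         mat33 a b c d e f g h i ** R (mat33 a' b' c' d' e' f' g' h' i') +
         mat33 a b c d e f g h i ** mat33 a' b' c' d' e' f' g' h' i')"
  shows "rota_baxter 1 R"
  unfolding rota_baxter_def
proof (intro conjI allI mlinearI)
  fix x y :: "'a mat3" and k
  obtain a b c d e f g h i where x: "x = mat33 a b c d e f g h i" by (rule mat33_cases)
  obtain a' b' c' d' e' f' g' h' i' where y: "y = mat33 a' b' c' d' e' f' g' h' i'"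
    by (rule mat33_cases)
  show "R (x + y) = R x + R y" unfolding x y by (rule assms(1))
  show "R (mscale k x) = mscale k (R x)" unfolding x by (rule assms(2))
  show "R x ** R y = R (R x ** y + x ** R y + mscale 1 (x ** y))"
    unfolding x y by (simp add: assms(3))
qed

text \<open>With the operators in explicit form, the identity is a family of polynomial identities
  in the 18 entries of two generic matrices.\<close>

lemma rota_baxter_ops_A:
  "rota_baxter 1 (op_a rho1)" "rota_baxter 1 (op_a rho2)" "rota_baxter 1 (op_a rho3)"
  "rota_baxter 1 (op_a rho4)" "rota_baxter 1 (op_a rho5)" "rota_baxter 1 (op_a rho6)"
  "rota_baxter 1 (op_a rho7)" "rota_baxter 1 (op_b rho1)" "rota_baxter 1 (op_b rho2)"
  "rota_baxter 1 (op_b rho3)" "rota_baxter 1 (op_b rho4)" "rota_baxter 1 (op_b rho5)"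
  "rota_baxter 1 (op_b rho6)" "rota_baxter 1 (op_b rho7)" "rota_baxter 1 (op_c rho1)"
  "rota_baxter 1 (op_c rho2)" "rota_baxter 1 (op_c rho3)" "rota_baxter 1 (op_c rho4)"
  "rota_baxter 1 (op_c rho6)" "rota_baxter 1 (op_c rho7)"
  by (rule rota_baxterI_mat33; simp add: op_mat33 mat33_simps algebra_simps)+

lemma rota_baxter_ops_BC:
  "rota_baxter 1 op_1_I" "rota_baxter 1 op_6_I" "rota_baxter 1 op_6_II"
  "rota_baxter 1 op_6_III" "rota_baxter 1 op_2_I" "rota_baxter 1 op_2_II"
  "rota_baxter 1 op_3_I" "rota_baxter 1 op_3_II" "rota_baxter 1 op_4_I"
  "rota_baxter 1 op_4_II" "rota_baxter 1 op_5_I" "rota_baxter 1 op_5_II"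
  "rota_baxter 1 op_6_IV" "rota_baxter 1 op_6_V" "rota_baxter 1 op_6_VI"
  "rota_baxter 1 op_8_I"
  by (rule rota_baxterI_mat33; simp add: op_mat33 mat33_simps algebra_simps)+

lemma rota_baxter_rb_ops:
  assumes "R \<in> set rb_ops"
  shows "rota_baxter 1 R"
  using assms rota_baxter_ops_A rota_baxter_ops_BC
  by (auto simp: rb_ops_def ops_A_def ops_B_def ops_C_def)

section \<open>Values of the invariants\<close>

lemma mlinear_eq_iff:
  assumes "mlinear S" "mlinear T"
  shows "(\<forall>x. S x = T x) \<longleftrightarrow> (\<forall>i j. S (E i j) = T (E i j))"
proof
  assume *: "\<forall>i j. S (E i j) = T (E i j)"
  have "S x $ i $ j = T x $ i $ j" for x i j
    using mlinear_entry[OF assms(1), of x i j] mlinear_entry[OF assms(2), of x i j] * by simp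
  then show "\<forall>x. S x = T x" by (simp add: vec_eq_iff)
qed simp

text \<open>The premises stage the computation: \<open>s\<close>, \<open>y\<close> and
  \<open>z\<close> are brought to explicit form one after another, and the commutation condition is
  tested on the nine matrix units only.\<close>

lemma rb_codeI:
  assumes "mlinear R" "dual_unit (sym_op R) = s" "sym_op R s = y" "sym_op R y = z"
    and "op_trace (sym_op R) * trace s = \<alpha>"
    and "(op_trace (\<lambda>x. sym_op R (bracket z x)))\<^sup>2 = \<beta>"
    and "(\<forall>i j. sym_op R (bracket y (E i j)) = bracket y (sym_op R (E i j))) = p"
  shows "rb_code R = (\<alpha>, \<beta>, p)"
proof -
  have "(\<forall>x. sym_op R (bracket y x) = bracket y (sym_op R x)) = p"
    unfolding assms(7)[symmetric]
    by (rule mlinear_eq_iff[OF mlinear_compose[OF mlinear_sym_op[OF assms(1)] mlinear_bracket]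
          mlinear_compose[OF mlinear_bracket mlinear_sym_op[OF assms(1)]]])
  then show ?thesis
    unfolding rb_code_def Let_def assms(2-6) by simp
qed

lemma sym_op_eq: "sym_op R x = mscale 2 (R x) + x"
  by (simp add: sym_op_def phi_op_def mscale_def vec_eq_iff)

lemma mlinear_rb_ops:
  assumes "R \<in> set rb_ops"
  shows "mlinear R"
  using rota_baxter_rb_ops[OF assms] by (simp add: rota_baxter_def)

lemmas rb_code_simps = op_trace_def sum_3 forall_3 dual_unit_mat33 bracket_def
  sym_op_eq mat33_0 mat33_E mat33_simps

text \<open>For a primitive operator \<open>q\<close> preserves the diagonal and acts on
  off-diagonal units by signs. Hence \<open>s\<close>, \<open>y\<close>, \<open>z\<close> are
  diagonal, \<open>q\<close> commutes with the bracket by \<open>y\<close>, and the second entry is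
  16 times the square of \<open>z $ 1 $ 1 - z $ 3 $ 3\<close>.\<close>

lemma rb_code_ops_A:
  "rb_code (op_a rho1 :: 'a::field_char_0 mat3 \<Rightarrow> 'a mat3) = (27, 36864, True)"
  "rb_code (op_a rho2 :: 'a::field_char_0 mat3 \<Rightarrow> 'a mat3) = (7, 3136, True)"
  "rb_code (op_a rho3 :: 'a::field_char_0 mat3 \<Rightarrow> 'a mat3) = (- 1, 23104, True)"
  "rb_code (op_a rho4 :: 'a::field_char_0 mat3 \<Rightarrow> 'a mat3) = (5, 4096, True)"
  "rb_code (op_a rho5 :: 'a::field_char_0 mat3 \<Rightarrow> 'a mat3) = (21, 4096, True)"
  "rb_code (op_a rho6 :: 'a::field_char_0 mat3 \<Rightarrow> 'a mat3) = (15, 64, True)"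
  "rb_code (op_a rho7 :: 'a::field_char_0 mat3 \<Rightarrow> 'a mat3) = (3, 256, True)"
  "rb_code (op_b rho1 :: 'a::field_char_0 mat3 \<Rightarrow> 'a mat3) = (27, 14400, True)"
  "rb_code (op_b rho2 :: 'a::field_char_0 mat3 \<Rightarrow> 'a mat3) = (7, 256, True)"
  "rb_code (op_b rho3 :: 'a::field_char_0 mat3 \<Rightarrow> 'a mat3) = (- 1, 14400, True)"
  "rb_code (op_b rho4 :: 'a::field_char_0 mat3 \<Rightarrow> 'a mat3) = (5, 7744, True)"
  "rb_code (op_b rho5 :: 'a::field_char_0 mat3 \<Rightarrow> 'a mat3) = (21, 0, True)"
  "rb_code (op_b rho6 :: 'a::field_char_0 mat3 \<Rightarrow> 'a mat3) = (15, 2304, True)"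
  "rb_code (op_b rho7 :: 'a::field_char_0 mat3 \<Rightarrow> 'a mat3) = (3, 3136, True)"
  "rb_code (op_c rho1 :: 'a::field_char_0 mat3 \<Rightarrow> 'a mat3) = (27, 5184, True)"
  "rb_code (op_c rho2 :: 'a::field_char_0 mat3 \<Rightarrow> 'a mat3) = (7, 5184, True)"
  "rb_code (op_c rho3 :: 'a::field_char_0 mat3 \<Rightarrow> 'a mat3) = (- 1, 1024, True)"
  "rb_code (op_c rho4 :: 'a::field_char_0 mat3 \<Rightarrow> 'a mat3) = (5, 576, True)"
  "rb_code (op_c rho6 :: 'a::field_char_0 mat3 \<Rightarrow> 'a mat3) = (15, 1600, True)"
  "rb_code (op_c rho7 :: 'a::field_char_0 mat3 \<Rightarrow> 'a mat3) = (3, 1600, True)"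
  by (rule rb_codeI, simp add: mlinear_rb_ops rb_ops_def ops_A_def ops_B_def ops_C_def,
    (simp add: rb_code_simps op_mat33)+)+

text \<open>Many of these operators share the first two entries with a primitive one, such as
  \<open>op_1_I\<close> with \<open>op_a rho1\<close>; the third entry then separates them.\<close>

lemma rb_code_ops_BC:
  "rb_code (op_1_I :: 'a::field_char_0 mat3 \<Rightarrow> 'a mat3) = (27, 36864, False)"
  "rb_code (op_6_I :: 'a::field_char_0 mat3 \<Rightarrow> 'a mat3) = (5, 576, False)"
  "rb_code (op_6_II :: 'a::field_char_0 mat3 \<Rightarrow> 'a mat3) = (25, 256, False)"
  "rb_code (op_6_III :: 'a::field_char_0 mat3 \<Rightarrow> 'a mat3) = (25, 256, False)"
  "rb_code (op_2_I :: 'a::field_char_0 mat3 \<Rightarrow> 'a mat3) = (7, 3136, False)"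
  "rb_code (op_2_II :: 'a::field_char_0 mat3 \<Rightarrow> 'a mat3) = (7, 5184, False)"
  "rb_code (op_3_I :: 'a::field_char_0 mat3 \<Rightarrow> 'a mat3) = (- 1, 23104, False)"
  "rb_code (op_3_II :: 'a::field_char_0 mat3 \<Rightarrow> 'a mat3) = (- 1, 14400, False)"
  "rb_code (op_4_I :: 'a::field_char_0 mat3 \<Rightarrow> 'a mat3) = (5, 4096, False)"
  "rb_code (op_4_II :: 'a::field_char_0 mat3 \<Rightarrow> 'a mat3) = (5, 7744, False)"
  "rb_code (op_5_I :: 'a::field_char_0 mat3 \<Rightarrow> 'a mat3) = (35, 4096, True)"
  "rb_code (op_5_II :: 'a::field_char_0 mat3 \<Rightarrow> 'a mat3) = (21, 4096, False)"
  "rb_code (op_6_IV :: 'a::field_char_0 mat3 \<Rightarrow> 'a mat3) = (15, 2304, False)"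
  "rb_code (op_6_V :: 'a::field_char_0 mat3 \<Rightarrow> 'a mat3) = (15, 1600, False)"
  "rb_code (op_6_VI :: 'a::field_char_0 mat3 \<Rightarrow> 'a mat3) = (25, 256, True)"
  "rb_code (op_8_I :: 'a::field_char_0 mat3 \<Rightarrow> 'a mat3) = (1, 64, False)"
  by (rule rb_codeI, simp add: mlinear_rb_ops rb_ops_def ops_A_def ops_B_def ops_C_def,
    (simp add: rb_code_simps op_mat33)+)+

section \<open>Separation of the pair 6-II, 6-III\<close>

lemma not_comm_annihilatedI:
  "R z ** bracket (R x) (R y) ** R w \<noteq> 0 \<Longrightarrow> \<not> comm_annihilated R"
  by (auto simp: comm_annihilated_def)

text \<open>The image is spanned by \<open>E 2 2\<close>, \<open>v = E 2 1 + E 2 3\<close> and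
  \<open>E 1 1 - E 3 1\<close>. All commutators are multiples of \<open>v\<close>, and
  \<open>v ** b = 0\<close> for every \<open>b\<close> in the image.\<close>

lemma comm_annihilated_op_6_III: "comm_annihilated op_6_III"
  unfolding comm_annihilated_def
proof (intro allI)
  fix x y z w :: "'a mat3"
  show "op_6_III z ** bracket (op_6_III x) (op_6_III y) ** op_6_III w = 0"
    by (rule mat33_cases[of x]; rule mat33_cases[of y]; rule mat33_cases[of z]; rule mat33_cases[of w])
      (simp add: op_mat33 bracket_def mat33_0 mat33_simps algebra_simps)
qed

text \<open>The first witness yields the product \<open>- E 2 1\<close>. For
  \<open>phi_op op_6_II\<close> the units \<open>E 2 2\<close>, \<open>E 2 3\<close>,
  \<open>E 3 3\<close> are sent to their negatives, and the product is \<open>E 2 3\<close>.\<close>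

lemma not_comm_annihilated_op_6_II:
  "\<not> comm_annihilated op_6_II" "\<not> comm_annihilated (phi_op op_6_II)"
  by (rule not_comm_annihilatedI[of _ "E 1 1" "E 1 1" "E 2 1" "E 3 1"],
      simp add: op_mat33 bracket_def mat33_0 mat33_E mat33_simps)
    (rule not_comm_annihilatedI[of _ "E 2 2" "E 2 2" "E 2 3" "E 3 3"],
      simp add: op_mat33 phi_op_def bracket_def mat33_0 mat33_E mat33_simps)

section \<open>Distinctness of the orbits\<close>

lemma distinct_orbit_codes:
  "distinct (map (\<lambda>R. (rb_code R, \<exists>S \<in> rb_orbit R. comm_annihilated S))
    (rb_ops :: ('a::field_char_0 mat3 \<Rightarrow> 'a mat3) list))"
proof -
  have "\<exists>S \<in> rb_orbit op_6_III. comm_annihilated (S :: 'a mat3 \<Rightarrow> 'a mat3)"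
    using mem_rb_orbit comm_annihilated_op_6_III by blast
  moreover have "\<not> (\<exists>S \<in> rb_orbit op_6_II. comm_annihilated (S :: 'a mat3 \<Rightarrow> 'a mat3))"
    using comm_annihilated_orbit not_comm_annihilated_op_6_II by blast
  ultimately show ?thesis
    by (simp add: rb_ops_def ops_A_def ops_B_def ops_C_def rb_code_ops_A rb_code_ops_BC)
qed

theorem corollary2:
  shows "(\<forall>R \<in> set (rb_ops :: ('a::{alg_closed_field, field_char_0} mat3 \<Rightarrow> 'a mat3) list).
      rota_baxter 1 R) \<and>
    (\<forall>i < 36. \<forall>j < 36. i \<noteq> j \<longrightarrow>
      rb_orbit (rb_ops ! i :: 'a mat3 \<Rightarrow> 'a mat3) \<noteq> rb_orbit (rb_ops ! j))"
proof (intro conjI ballI allI impI notI)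
  show "rota_baxter 1 R" if "R \<in> set rb_ops" for R :: "'a mat3 \<Rightarrow> 'a mat3"
    using that by (rule rota_baxter_rb_ops)
next
  let ?ops = "rb_ops :: ('a mat3 \<Rightarrow> 'a mat3) list"
  let ?code = "\<lambda>R. (rb_code R, \<exists>S \<in> rb_orbit R. comm_annihilated S)"
  fix i j :: nat
  assume ij: "i < 36" "j < 36" "i \<noteq> j" and eq: "rb_orbit (?ops ! i) = rb_orbit (?ops ! j)"
  have "rb_code (?ops ! i) = rb_code (?ops ! j)"
    using ij eq by (intro rb_code_orbit mlinear_rb_ops nth_mem) (simp_all add: length_rb_ops)
  \<comment> \<open>The second component of the code depends on the orbit alone, so equality of the
    orbits settles it.\<close>
  with eq have "map ?code ?ops ! i = map ?code ?ops ! j"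
    using ij by (simp add: length_rb_ops)
  then show False
    using ij nth_eq_iff_index_eq[OF distinct_orbit_codes[where 'a = 'a], of i j]
    by (simp add: length_rb_ops)
qed

end
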